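(* Let $T$ be an interval exchange map of $d\ge 2$ intervals with admissible combinatorial data, with the Keane property, and with total length $\lambda^*=1$. Suppose that $\lim_{r\to0^+}\frac{\log\tau_r(x)}{-\log r}=1$ uniformly in $x\in[0,1)$ (Condition (U)). Then for every $\varepsilon>0$ there is $C_\varepsilon>0$ such that $\|Z(k,k+1)\|\le C_\varepsilon\|Z(k)\|^{\varepsilon}$ for all $k\ge1$ (Condition (Z)).
   Context: Interval exchange maps. Let $\mathcal A$ be an alphabet with $d\ge2$ letters. Combinatorial data is a pair $\pi=(\pi_t,\pi_b)$ of bijections $\mathcal A\to\{1,\dots,d\}$; it is admissible if $\pi_t^{-1}(\{1,\dots,k\})\ne\pi_b^{-1}(\{1,\dots,k\})$ for $k=1,\dots,d-1$. Length data is a vector $(\lambda_\alpha)_{\alpha\in\mathcal A}$ of positive reals; $\lambda^*=\sum_\alpha\lambda_\alpha$, $I=[0,\lambda^* )$, $p_\alpha=\sum_{\pi_t(\beta)<\pi_t(\alpha)}\lambda_\beta$, $I_\alpha=[p_\alpha,p_\alpha+\lambda_\alpha)$. The map is $T(x)=x+\sum_{\pi_b(\beta)<\pi_b(\alpha)}\lambda_\beta-\sum_{\pi_t(\beta)<\pi_t(\alpha)}\lambda_\beta$ for $x\in I_\alpha$. Keane property: there are no $\alpha,\beta\in\mathcal A$ and $m\ge1$ with $T^m(p_\alpha)=p_\beta$ and $\pi_t(\beta)>1$. Return time. $\tau_r(x)=\min\{j\ge1:\ |T^jx-x|<r\}$ for $r>0$, $x\in I$. Rauzy–Veech algorithm.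 Let $\alpha_t,\alpha_b$ be the letters with $\pi_t(\alpha_t)=\pi_b(\alpha_b)=d$. If $\lambda_{\alpha_t}>\lambda_{\alpha_b}$ (top type) the winner is $\alpha_t$ and the loser $\alpha_b$; the new data keep $\pi_t$, and in the order given by $\pi_b$ the letter $\alpha_b$ is moved to the position immediately after $\alpha_t$. If $\lambda_{\alpha_b}>\lambda_{\alpha_t}$ (bottom type) the winner is $\alpha_b$ and the loser $\alpha_t$; the new data keep $\pi_b$, and in the order given by $\pi_t$ the letter $\alpha_t$ is moved to the position immediately after $\alpha_b$. In both cases the winner's length is replaced by (winner's length minus loser's length) and all other lengths are kept. The new map $\mathcal V(T)$ is the first return map of $T$ to $[0,\sum_\alpha\hat\lambda_\alpha)$, where $\hat\lambda$ is the new length vector. For $T$ admissible with the Keane property this can be iterated forever; $T(n)=\mathcal V^n(T)$. Write $\gamma(m,n)$ for the sequence of steps (arrows) from $T(m)$ to $T(n)$. For a step with winner $\alpha$ and loser $\beta$ put $B=\mathbb I+E_{\beta\alpha}$ ($E_{\beta\alpha}$ has its only nonzero entry, a $1$, in row $\beta$, column $\alpha$); $Q(m,n)$ is the product of the matrices of the steps of $\gamma(m,n)$, later steps on the left. The norm $\|\cdot\|$ of a matrix is the sum of the absolute values of its entries. Zorich acceleration. $n_0=0$ and $n_{k+1}>n_k$ is the largest integer such that all steps in $\gamma(n_k,n_{k+1})$ have the same winner. $Z(k)=Q(0,n_k)$, $Z(k,\ell)=Q(n_k,n_\ell)$. *)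

theory Defs
  imports "HOL-Analysis.Analysis"
begin

text \<open>The alphabet is a finite type \<^typ>\<open>'a\<close>, so that the number of letters is \<open>d = CARD('a)\<close>.\<close>

record 'a iet =
  top_pos :: "'a \<Rightarrow> nat"
  bot_pos :: "'a \<Rightarrow> nat"
  len :: "'a \<Rightarrow> real"

definition iet_data :: "('a::finite) iet \<Rightarrow> bool" where
  "iet_data D \<longleftrightarrow>
     bij_betw (top_pos D) UNIV {1..CARD('a)} \<and>
     bij_betw (bot_pos D) UNIV {1..CARD('a)} \<and>
     (\<forall>\<alpha>. len D \<alpha> > 0)"

definition admissible :: "('a::finite) iet \<Rightarrow> bool" where
  "admissible D \<longleftrightarrow>
     (\<forall>k\<in>{1..CARD('a) - 1}. top_pos D -` {1..k} \<noteq> bot_pos D -` {1..k})"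

definition total_length :: "('a::finite) iet \<Rightarrow> real" where
  "total_length D = (\<Sum>\<alpha>\<in>UNIV. len D \<alpha>)"

definition left_endpoint :: "('a::finite) iet \<Rightarrow> 'a \<Rightarrow> real" where
  "left_endpoint D \<alpha> = (\<Sum>\<beta> | top_pos D \<beta> < top_pos D \<alpha>. len D \<beta>)"

definition subinterval :: "('a::finite) iet \<Rightarrow> 'a \<Rightarrow> real set" where
  "subinterval D \<alpha> = {left_endpoint D \<alpha> ..< left_endpoint D \<alpha> + len D \<alpha>}"

text \<open>Only meaningful for \<open>x\<close> in \<open>[0, total_length D)\<close>, which is the disjoint union of the
  subintervals and is mapped to itself.\<close>

definition iet_map :: "('a::finite) iet \<Rightarrow> real \<Rightarrow> real" where
  "iet_map D x =
     (let \<alpha> = (THE \<alpha>. x \<in> subinterval D \<alpha>)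
      in x + (\<Sum>\<beta> | bot_pos D \<beta> < bot_pos D \<alpha>. len D \<beta>)
           - (\<Sum>\<beta> | top_pos D \<beta> < top_pos D \<alpha>. len D \<beta>))"

definition keane :: "('a::finite) iet \<Rightarrow> bool" where
  "keane D \<longleftrightarrow>
     \<not> (\<exists>\<alpha> \<beta>. \<exists>m\<ge>1. (iet_map D ^^ m) (left_endpoint D \<alpha>) = left_endpoint D \<beta> \<and> top_pos D \<beta> > 1)"

text \<open>Such a \<open>j\<close> exists for every point of the interval when the data are admissible with the
  Keane property, the map then being minimal.\<close>

definition return_time :: "('a::finite) iet \<Rightarrow> real \<Rightarrow> real \<Rightarrow> nat" where
  "return_time D r x = (LEAST j. j \<ge> 1 \<and> \<bar>(iet_map D ^^ j) x - x\<bar> < r)"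

definition top_last :: "('a::finite) iet \<Rightarrow> 'a" where
  "top_last D = (THE \<alpha>. top_pos D \<alpha> = CARD('a))"

definition bot_last :: "('a::finite) iet \<Rightarrow> 'a" where
  "bot_last D = (THE \<alpha>. bot_pos D \<alpha> = CARD('a))"

definition top_type :: "('a::finite) iet \<Rightarrow> bool" where
  "top_type D \<longleftrightarrow> len D (top_last D) > len D (bot_last D)"

definition bottom_type :: "('a::finite) iet \<Rightarrow> bool" where
  "bottom_type D \<longleftrightarrow> len D (bot_last D) > len D (top_last D)"

text \<open>In the order given by \<open>p\<close>, the last letter is moved to the position immediately after \<open>\<alpha>\<close>.\<close>

definition move_last_after :: "'a \<Rightarrow> ('a::finite \<Rightarrow> nat) \<Rightarrow> 'a \<Rightarrow> nat" where
  "move_last_after \<alpha> p \<beta> =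
     (if p \<beta> \<le> p \<alpha> then p \<beta>
      else if p \<beta> = CARD('a) then p \<alpha> + 1
      else p \<beta> + 1)"

text \<open>If the two last letters have equal length, no step is defined, and the values below are
  irrelevant; for admissible data with the Keane property this never occurs along the iteration.\<close>

definition winner :: "('a::finite) iet \<Rightarrow> 'a" where
  "winner D = (if top_type D then top_last D else bot_last D)"

definition loser :: "('a::finite) iet \<Rightarrow> 'a" where
  "loser D = (if top_type D then bot_last D else top_last D)"

text \<open>The step on data; the interval exchange map of the new data is the first return map of
  the old one to the interval of the new total length.\<close>

definition rv_step :: "('a::finite) iet \<Rightarrow> 'a iet" where
  "rv_step D =
     (if top_type D then
        \<lparr>top_pos = top_pos D,
         bot_pos = move_last_after (top_last D) (bot_pos D),
         len = (len D)(winner D := len D (winner D) - len D (loser D))\<rparr>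
      else if bottom_type D then
        \<lparr>top_pos = move_last_after (bot_last D) (top_pos D),
         bot_pos = bot_pos D,
         len = (len D)(winner D := len D (winner D) - len D (loser D))\<rparr>
      else D)"

definition rv_iter :: "('a::finite) iet \<Rightarrow> nat \<Rightarrow> 'a iet" where
  "rv_iter D n = (rv_step ^^ n) D"

definition elem_mat :: "'a::finite \<Rightarrow> 'a \<Rightarrow> real^'a^'a" where
  "elem_mat \<beta> \<alpha> = (\<chi> i j. if i = \<beta> \<and> j = \<alpha> then 1 else 0)"

definition step_mat :: "('a::finite) iet \<Rightarrow> real^'a^'a" where
  "step_mat D = mat 1 + elem_mat (loser D) (winner D)"

text \<open>\<open>Q(m,n) = B(n-1) ** \<dots> ** B(m)\<close>, where \<open>B(i)\<close> is the matrix of the step from \<open>T(i)\<close> to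
  \<open>T(i+1)\<close>; it is the identity for \<open>n \<le> m\<close>.\<close>

primrec rv_mat :: "('a::finite) iet \<Rightarrow> nat \<Rightarrow> nat \<Rightarrow> real^'a^'a" where
  "rv_mat D m 0 = mat 1"
| "rv_mat D m (Suc n) =
     (if m \<le> n then step_mat (rv_iter D n) ** rv_mat D m n else mat 1)"

text \<open>The sum of the absolute values of the entries, not the Euclidean \<open>norm\<close> of the type.\<close>

definition mat_norm :: "real^'n^'m \<Rightarrow> real" where
  "mat_norm A = (\<Sum>i\<in>UNIV. \<Sum>j\<in>UNIV. \<bar>A $ i $ j\<bar>)"

primrec zorich_time :: "('a::finite) iet \<Rightarrow> nat \<Rightarrow> nat" where
  "zorich_time D 0 = 0"
| "zorich_time D (Suc k) =
     (GREATEST n. n > zorich_time D k \<and>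
        (\<exists>\<alpha>. \<forall>i\<in>{zorich_time D k..<n}. winner (rv_iter D i) = \<alpha>))"

definition zorich_mat :: "('a::finite) iet \<Rightarrow> nat \<Rightarrow> nat \<Rightarrow> real^'a^'a" where
  "zorich_mat D k l = rv_mat D (zorich_time D k) (zorich_time D l)"

definition condition_U :: "('a::finite) iet \<Rightarrow> bool" where
  "condition_U D \<longleftrightarrow>
     uniform_limit {0..<1} (\<lambda>r x. ln (real (return_time D r x)) / (- ln r)) (\<lambda>x. 1) (at_right 0)"

text \<open>\<open>Z(k)\<close> is \<open>zorich_mat D 0 k\<close>, since the zeroth Zorich time is \<open>0\<close>.\<close>

definition condition_Z :: "('a::finite) iet \<Rightarrow> bool" where
  "condition_Z D \<longleftrightarrow>
     (\<forall>\<epsilon>>0. \<exists>C>0. \<forall>k\<ge>1.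
        mat_norm (zorich_mat D k (k + 1)) \<le> C * mat_norm (zorich_mat D 0 k) powr \<epsilon>)"

end

theory Submission
  imports Defs
begin

text \<open>Let \<open>\<alpha>\<close> be the winner at stage \<open>n = n\<^sub>k\<close>, let \<open>R\<close> be the sum of row \<open>\<alpha>\<close> of \<open>Z(k)\<close>, and let
  \<open>W\<close> be the total length of the letters that follow \<open>\<alpha>\<close> in the row in which \<open>\<alpha>\<close> is not last.
  On the subinterval of \<open>\<alpha>\<close> the map \<open>T(n)\<close> equals \<open>T\<^sup>R\<close> and is a translation by \<open>W\<close> in absolute
  value, so Condition (U) forces \<open>2 W \<ge> R powr - (1 + \<epsilon>)\<close> as soon as \<open>W\<close> is small.
  The lengths at stage \<open>n\<close>, weighted by the row sums of \<open>Z(k)\<close>, add up to \<open>\<lambda>\<^sup>* = 1\<close>, so the length of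
  \<open>\<alpha>\<close> is at most \<open>1 / R\<close>. While \<open>\<alpha>\<close> keeps winning, the losers run cyclically through the letters
  that make up \<open>W\<close>, so the number of such steps is at most a constant times
  \<open>1 + \<lambda>\<^sub>\<alpha> / W\<close>, which is of order \<open>R powr \<epsilon>\<close>; and \<open>\<parallel>Z(k,k+1)\<parallel>\<close> is this number plus \<open>d\<close>.\<close>

subsection \<open>Partial sums along an ordering\<close>

text \<open>For the top row this is the left endpoint of a subinterval, for the bottom row that of
  its image; keeping \<open>p\<close> and \<open>l\<close> free lets the same lemmas serve both
  rows.\<close>

definition offset :: "('a::finite \<Rightarrow> nat) \<Rightarrow> ('a \<Rightarrow> real) \<Rightarrow> 'a \<Rightarrow> real" where
  "offset p l \<xi> = (\<Sum>\<psi> | p \<psi> < p \<xi>. l \<psi>)"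

abbreviation numbering :: "('a::finite \<Rightarrow> nat) \<Rightarrow> bool" where
  "numbering p \<equiv> bij_betw p UNIV {1..CARD('a)}"

lemma numbering_inj: "numbering p \<Longrightarrow> p x = p y \<longleftrightarrow> x = y"
  by (auto simp: bij_betw_def inj_on_def)

lemma numbering_bounds:
  fixes p :: "'a::finite \<Rightarrow> nat"
  assumes "numbering p"
  shows "1 \<le> p x" "p x \<le> CARD('a)"
  using bij_betwE[OF assms] by auto

lemma numbering_surj:
  fixes p :: "'a::finite \<Rightarrow> nat"
  assumes "numbering p" "1 \<le> k" "k \<le> CARD('a)"
  shows "\<exists>x. p x = k"
proof -
  have "k \<in> range p" using assms by (auto simp: bij_betw_def)
  then show ?thesis by auto
qed

lemma numbering_last:
  fixes p :: "'a::finite \<Rightarrow> nat"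
  assumes "numbering p"
  shows "p (THE x. p x = CARD('a)) = CARD('a)"
proof -
  obtain x where x: "p x = CARD('a)"
    using numbering_surj[OF assms, of "CARD('a)"] by (auto simp: Suc_le_eq)
  show ?thesis
    by (rule theI[where P = "\<lambda>x. p x = CARD('a)", OF x])
      (use x numbering_inj[OF assms] in metis)
qed

lemma offset_cong:
  "(\<And>\<psi>. p \<psi> < p \<xi> \<Longrightarrow> l \<psi> = l' \<psi>) \<Longrightarrow> offset p l \<xi> = offset p l' \<xi>"
  unfolding offset_def by (rule sum.cong) auto

lemma offset_nonneg: "(\<And>x. 0 < l x) \<Longrightarrow> 0 \<le> offset p l \<xi>"
  unfolding offset_def by (rule sum_nonneg) (auto intro: less_imp_le)

lemma offset_add_le:
  assumes "\<And>x. 0 < l x" "p \<xi> < p \<psi>"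
  shows "offset p l \<xi> + l \<xi> \<le> offset p l \<psi>"
proof -
  have "offset p l \<xi> + l \<xi> = sum l (insert \<xi> {x. p x < p \<xi>})"
    by (simp add: offset_def)
  also have "\<dots> \<le> sum l {x. p x < p \<psi>}"
    by (rule sum_mono2) (use assms in \<open>auto intro: less_imp_le\<close>)
  finally show ?thesis by (simp add: offset_def)
qed

lemma offset_Suc:
  assumes "numbering p" "p \<psi> = Suc (p \<xi>)"
  shows "offset p l \<psi> = offset p l \<xi> + l \<xi>"
proof -
  have "{x. p x < p \<psi>} = insert \<xi> {x. p x < p \<xi>}"
    using assms(2) numbering_inj[OF assms(1)] by (auto simp: less_Suc_eq)
  then show ?thesis by (simp add: offset_def)
qed

lemma offset_inj:
  assumes "numbering p" "\<And>x. 0 < l x" "offset p l \<xi> = offset p l \<psi>"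
  shows "\<xi> = \<psi>"
proof (rule ccontr)
  assume "\<xi> \<noteq> \<psi>"
  then have "p \<xi> < p \<psi> \<or> p \<psi> < p \<xi>"
    using numbering_inj[OF assms(1)] by (metis linorder_neqE_nat)
  then show False
    using offset_add_le[of l p \<xi> \<psi>] offset_add_le[of l p \<psi> \<xi>] assms(2)[of \<xi>] assms(2)[of \<psi>]
      assms(2,3) by auto
qed

lemma sum_eq_offset:
  assumes "numbering p"
  shows "sum l UNIV = offset p l \<xi> + l \<xi> + (\<Sum>\<psi> | p \<xi> < p \<psi>. l \<psi>)"
proof -
  have "UNIV = insert \<xi> {\<psi>. p \<psi> < p \<xi>} \<union> {\<psi>. p \<xi> < p \<psi>}"
    using numbering_inj[OF assms] by (auto simp: not_less_iff_gr_or_eq)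
  then have "sum l UNIV = sum l (insert \<xi> {\<psi>. p \<psi> < p \<xi>} \<union> {\<psi>. p \<xi> < p \<psi>})"
    by simp
  also have "\<dots> = sum l (insert \<xi> {\<psi>. p \<psi> < p \<xi>}) + (\<Sum>\<psi> | p \<xi> < p \<psi>. l \<psi>)"
    by (rule sum.union_disjoint) auto
  finally show ?thesis by (simp add: offset_def)
qed

lemma offset_last:
  fixes p :: "'a::finite \<Rightarrow> nat"
  assumes "numbering p" "p \<xi> = CARD('a)"
  shows "offset p l \<xi> = sum l UNIV - l \<xi>"
proof -
  have "{\<psi>. p \<xi> < p \<psi>} = {}"
    using numbering_bounds(2)[OF assms(1)] assms(2) by (auto simp: not_less)
  then show ?thesis using sum_eq_offset[OF assms(1), of l \<xi>] by simp
qed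

lemma offset_add_le_sum:
  assumes "numbering p" "\<And>x. 0 < l x"
  shows "offset p l \<xi> + l \<xi> \<le> sum l UNIV"
  using sum_nonneg[of "{\<psi>. p \<xi> < p \<psi>}" l] assms(2)
  by (auto simp: sum_eq_offset[OF assms(1), of l \<xi>] less_imp_le)

text \<open>Among the letters with offset at most \<open>x\<close>, the one of largest position
  works: its successor, if any, starts to the right of \<open>x\<close>.\<close>

lemma ex_offset_interval:
  fixes p :: "'a::finite \<Rightarrow> nat"
  assumes p: "numbering p" and l: "\<And>x. 0 < l x" and x: "0 \<le> x" "x < sum l UNIV"
  shows "\<exists>\<xi>. offset p l \<xi> \<le> x \<and> x < offset p l \<xi> + l \<xi>"
proof -
  let ?S = "{\<xi>. offset p l \<xi> \<le> x}"
  obtain \<phi> where \<phi>: "p \<phi> = 1"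
    using numbering_surj[OF p, of 1] by (auto simp: Suc_le_eq)
  have "{\<psi>. p \<psi> < p \<phi>} = {}"
    using numbering_bounds(1)[OF p] \<phi> by (auto simp: Suc_le_eq)
  then have "\<phi> \<in> ?S" using x by (simp add: offset_def)
  then have ne: "p ` ?S \<noteq> {}" by auto
  have "Max (p ` ?S) \<in> p ` ?S" using ne by (intro Max_in) auto
  then obtain \<xi> where \<xi>: "\<xi> \<in> ?S" "p \<xi> = Max (p ` ?S)" by (metis (no_types) imageE)
  have max: "p \<psi> \<le> p \<xi>" if "\<psi> \<in> ?S" for \<psi>
    unfolding \<xi>(2) using that by (intro Max_ge) auto
  have "x < offset p l \<xi> + l \<xi>"
  proof (cases "p \<xi> = CARD('a)")
    case True
    then show ?thesis using offset_last[OF p True, of l] x by simp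
  next
    case False
    then obtain \<psi> where \<psi>: "p \<psi> = Suc (p \<xi>)"
      using numbering_surj[OF p, of "Suc (p \<xi>)"] numbering_bounds[OF p, of \<xi>] by auto
    then have "\<psi> \<notin> ?S" using max by fastforce
    then show ?thesis using offset_Suc[OF p \<psi>, of l] by auto
  qed
  then show ?thesis using \<xi> by auto
qed

section \<open>Moving the last letter of an ordering\<close>

lemma numbering_move_last_after:
  fixes p :: "'a::finite \<Rightarrow> nat"
  assumes p: "numbering p" and "p \<alpha> < CARD('a)"
  shows "numbering (move_last_after \<alpha> p)"
proof -
  \<comment> \<open>The move acts on positions alone, through this map; an injective self-map of a
    finite set is a permutation.\<close>
  let ?\<sigma> = "\<lambda>i. if i \<le> p \<alpha> then i else if i = CARD('a) then p \<alpha> + 1 else i + 1"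
  have "inj_on ?\<sigma> {1..CARD('a)}"
    by (auto simp: inj_on_def split: if_splits)
  moreover have "?\<sigma> ` {1..CARD('a)} \<subseteq> {1..CARD('a)}"
    using assms(2) by auto
  ultimately have "bij_betw ?\<sigma> {1..CARD('a)} {1..CARD('a)}"
    by (metis (no_types, lifting) bij_betw_def endo_inj_surj finite_atLeastAtMost)
  from bij_betw_trans[OF p this]
  have "numbering (?\<sigma> \<circ> p)" .
  moreover have "?\<sigma> \<circ> p = move_last_after \<alpha> p"
    by (auto simp: move_last_after_def fun_eq_iff)
  ultimately show ?thesis by simp
qed

lemma move_last_after_simps:
  fixes p :: "'a::finite \<Rightarrow> nat"
  assumes p: "numbering p" and last: "p \<beta> = CARD('a)" and ne: "\<alpha> \<noteq> \<beta>"
  shows "p \<xi> \<le> p \<alpha> \<Longrightarrow> move_last_after \<alpha> p \<xi> = p \<xi>"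
    and "move_last_after \<alpha> p \<beta> = Suc (p \<alpha>)"
    and "p \<alpha> < p \<xi> \<Longrightarrow> \<xi> \<noteq> \<beta> \<Longrightarrow> move_last_after \<alpha> p \<xi> = Suc (p \<xi>)"
    and "p \<alpha> < p \<beta>"
proof -
  have "p \<alpha> \<noteq> p \<beta>" using ne numbering_inj[OF p] by auto
  then show lt: "p \<alpha> < p \<beta>" using numbering_bounds(2)[OF p, of \<alpha>] last by simp
  show "p \<xi> \<le> p \<alpha> \<Longrightarrow> move_last_after \<alpha> p \<xi> = p \<xi>"
    by (simp add: move_last_after_def)
  show "move_last_after \<alpha> p \<beta> = Suc (p \<alpha>)"
    using lt last by (simp add: move_last_after_def)
  show "move_last_after \<alpha> p \<xi> = Suc (p \<xi>)" if "p \<alpha> < p \<xi>" "\<xi> \<noteq> \<beta>"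
  proof -
    have "p \<xi> \<noteq> p \<beta>" using that numbering_inj[OF p] by auto
    then show ?thesis using that last by (simp add: move_last_after_def)
  qed
qed

lemma move_last_after_le_iff:
  fixes p :: "'a::finite \<Rightarrow> nat"
  assumes p: "numbering p" and last: "p \<beta> = CARD('a)" and ne: "\<alpha> \<noteq> \<beta>"
  shows "move_last_after \<alpha> p \<xi> \<le> p \<alpha> \<longleftrightarrow> p \<xi> \<le> p \<alpha>"
  using move_last_after_simps(1,3)[OF assms, of \<xi>] move_last_after_simps(2,4)[OF assms]
  by (cases "p \<xi> \<le> p \<alpha>"; cases "\<xi> = \<beta>") auto

text \<open>\<open>\<beta>\<close> is inserted right behind \<open>\<alpha>\<close>, whose length
  drops by \<open>l \<beta>\<close>. For the letters further back the inserted and the removed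
  length cancel, and \<open>\<beta>\<close> now ends where \<open>\<alpha>\<close> used to
  end.\<close>

lemma offset_move_last_after:
  fixes p :: "'a::finite \<Rightarrow> nat" and l :: "'a \<Rightarrow> real"
  assumes p: "numbering p" and last: "p \<beta> = CARD('a)" and ne: "\<alpha> \<noteq> \<beta>"
  defines "p' \<equiv> move_last_after \<alpha> p" and "l' \<equiv> l(\<alpha> := l \<alpha> - l \<beta>)"
  shows "offset p' l' \<beta> = offset p l \<alpha> + l \<alpha> - l \<beta>"
    and "\<xi> \<noteq> \<beta> \<Longrightarrow> offset p' l' \<xi> = offset p l \<xi>"
proof -
  note simps = move_last_after_simps[OF p last ne, folded p'_def]
  note le_iff = move_last_after_le_iff[OF p last ne, folded p'_def]
  have "p' \<psi> < p' \<beta> \<longleftrightarrow> p \<psi> \<le> p \<alpha>" for \<psi>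
    using le_iff by (simp add: simps(2) less_Suc_eq_le)
  then have "{\<psi>. p' \<psi> < p' \<beta>} = insert \<alpha> {\<psi>. p \<psi> < p \<alpha>}"
    using numbering_inj[OF p] by (auto simp: le_less)
  moreover have "sum l' {\<psi>. p \<psi> < p \<alpha>} = sum l {\<psi>. p \<psi> < p \<alpha>}"
    by (rule sum.cong) (auto simp: l'_def)
  ultimately show "offset p' l' \<beta> = offset p l \<alpha> + l \<alpha> - l \<beta>"
    by (simp add: offset_def l'_def)
  assume \<xi>: "\<xi> \<noteq> \<beta>"
  show "offset p' l' \<xi> = offset p l \<xi>"
  proof (cases "p \<xi> \<le> p \<alpha>")
    case True
    have "p' \<psi> < p' \<xi> \<longleftrightarrow> p \<psi> < p \<xi>" for \<psi>
    proof (cases "p \<psi> \<le> p \<alpha>")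
      case False
      then have "\<not> p' \<psi> \<le> p \<alpha>" using le_iff by blast
      then show ?thesis using False True simps(1) by auto
    qed (use True simps(1) in auto)
    then have "offset p' l' \<xi> = sum l' {\<psi>. p \<psi> < p \<xi>}" by (simp add: offset_def)
    also have "\<dots> = offset p l \<xi>"
      unfolding offset_def by (rule sum.cong) (use True in \<open>auto simp: l'_def\<close>)
    finally show ?thesis .
  next
    case False
    have "p \<xi> \<noteq> p \<beta>" using \<xi> numbering_inj[OF p] by auto
    then have lt: "p \<xi> < p \<beta>" using numbering_bounds(2)[OF p, of \<xi>] last by simp
    have p\<xi>: "p' \<xi> = Suc (p \<xi>)" using simps(3) False \<xi> by auto
    have "p' \<psi> < p' \<xi> \<longleftrightarrow> \<psi> = \<beta> \<or> p \<psi> < p \<xi>" for \<psi>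
      using simps(1)[of \<psi>] simps(2) simps(3)[of \<psi>] False p\<xi>
      by (cases "\<psi> = \<beta>"; cases "p \<psi> \<le> p \<alpha>") auto
    then have "{\<psi>. p' \<psi> < p' \<xi>} = insert \<beta> {\<psi>. p \<psi> < p \<xi>}" by auto
    then have "offset p' l' \<xi> = l \<beta> + sum l' {\<psi>. p \<psi> < p \<xi>}"
      using lt ne by (simp add: offset_def l'_def)
    also have "sum l' {\<psi>. p \<psi> < p \<xi>} = sum l {\<psi>. p \<psi> < p \<xi>} - l \<beta>"
      using False
      by (simp add: l'_def sum.remove[of "{\<psi>. p \<psi> < p \<xi>}" \<alpha>])
    finally show ?thesis by (simp add: offset_def)
  qed
qed

subsection \<open>The map on its subintervals\<close>

lemma left_endpoint_eq_offset: "left_endpoint D \<xi> = offset (top_pos D) (len D) \<xi>"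
  by (simp add: left_endpoint_def offset_def)

lemma iet_map_subinterval:
  assumes D: "iet_data D" and x: "x \<in> subinterval D \<xi>"
  shows "iet_map D x = x + offset (bot_pos D) (len D) \<xi> - offset (top_pos D) (len D) \<xi>"
proof -
  have p: "numbering (top_pos D)" and l: "\<And>x. 0 < len D x"
    using D by (auto simp: iet_data_def)
  have "\<psi> = \<xi>" if \<psi>: "x \<in> subinterval D \<psi>" for \<psi>
  proof (rule ccontr)
    assume "\<psi> \<noteq> \<xi>"
    then have "top_pos D \<xi> < top_pos D \<psi> \<or> top_pos D \<psi> < top_pos D \<xi>"
      using numbering_inj[OF p] by (metis linorder_neqE_nat)
    then show False
      using offset_add_le[of "len D" "top_pos D" \<xi> \<psi>, OF l]
        offset_add_le[of "len D" "top_pos D" \<psi> \<xi>, OF l] \<psi> x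
      by (auto simp: subinterval_def left_endpoint_eq_offset)
  qed
  then have "(THE \<alpha>. x \<in> subinterval D \<alpha>) = \<xi>" using x by blast
  then show ?thesis by (simp add: iet_map_def offset_def)
qed

lemma ex_subinterval:
  assumes "iet_data D" "x \<in> {0..<total_length D}"
  shows "\<exists>\<xi>. x \<in> subinterval D \<xi>"
  using ex_offset_interval[of "top_pos D" "len D" x] assms
  by (auto simp: iet_data_def total_length_def subinterval_def left_endpoint_eq_offset)

lemma iet_map_in:
  assumes D: "iet_data D" and x: "x \<in> {0..<total_length D}"
  shows "iet_map D x \<in> {0..<total_length D}"
proof -
  obtain \<xi> where \<xi>: "x \<in> subinterval D \<xi>" using ex_subinterval[OF assms] by auto
  have "numbering (bot_pos D)" and l: "\<And>x. 0 < len D x"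
    using D by (auto simp: iet_data_def)
  then have "offset (bot_pos D) (len D) \<xi> + len D \<xi> \<le> total_length D"
    "0 \<le> offset (bot_pos D) (len D) \<xi>"
    using offset_add_le_sum offset_nonneg unfolding total_length_def by metis+
  then show ?thesis
    using \<xi> by (auto simp: iet_map_subinterval[OF D \<xi>] subinterval_def left_endpoint_eq_offset)
qed

lemma left_endpoint_in_subinterval: "iet_data D \<Longrightarrow> left_endpoint D \<xi> \<in> subinterval D \<xi>"
  by (auto simp: subinterval_def iet_data_def)

lemma left_endpoint_in:
  assumes "iet_data D"
  shows "left_endpoint D \<xi> \<in> {0..<total_length D}"
proof -
  have p: "numbering (top_pos D)" and l: "\<And>x. 0 < len D x"
    using assms by (auto simp: iet_data_def)
  show ?thesis
    using offset_add_le_sum[of "top_pos D" "len D" \<xi>, OF p l]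
      offset_nonneg[of "len D" "top_pos D" \<xi>, OF l] l[of \<xi>]
    by (auto simp: left_endpoint_eq_offset total_length_def)
qed

subsection \<open>One Rauzy--Veech step\<close>

text \<open>Bundles the hypotheses that a step passes on to the new data, so that facts about one
  step apply along the whole iteration.\<close>

definition regular :: "('a::finite) iet \<Rightarrow> bool" where
  "regular D \<longleftrightarrow> CARD('a) \<ge> 2 \<and> iet_data D \<and> admissible D \<and> keane D"

text \<open>The row that ends with the winner and is kept by the step; \<open>lose_pos\<close> is
  the row that gets rearranged. In these terms top and bottom steps share most proofs.\<close>

definition win_pos :: "('a::finite) iet \<Rightarrow> 'a \<Rightarrow> nat" where
  "win_pos D = (if top_type D then top_pos D else bot_pos D)"

definition lose_pos :: "('a::finite) iet \<Rightarrow> 'a \<Rightarrow> nat" where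
  "lose_pos D = (if top_type D then bot_pos D else top_pos D)"

text \<open>The distance by which the map translates the subinterval of the winner.\<close>

definition shift :: "('a::finite) iet \<Rightarrow> real" where
  "shift D = (\<Sum>\<xi> | lose_pos D (winner D) < lose_pos D \<xi>. len D \<xi>)"

text \<open>Chosen so that a step which does not change the winner decreases it by exactly \<open>shift D\<close>: the
  winner loses the length of the loser, whose distance to the winner (at position \<open>a\<close>) drops from
  \<open>d - a\<close> to \<open>1\<close>, while the distance of every other letter behind the winner grows by one.\<close>

definition potential :: "('a::finite) iet \<Rightarrow> real" where
  "potential D =
     (real CARD('a) - real (lose_pos D (winner D))) * len D (winner D) -
     (\<Sum>\<xi> | lose_pos D (winner D) < lose_pos D \<xi>.
       (real (lose_pos D \<xi>) - real (lose_pos D (winner D))) * len D \<xi>)"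

lemma top_pos_top_last:
  fixes D :: "'a::finite iet"
  shows "iet_data D \<Longrightarrow> top_pos D (top_last D) = CARD('a)"
  unfolding iet_data_def top_last_def by (blast intro: numbering_last)

lemma bot_pos_bot_last:
  fixes D :: "'a::finite iet"
  shows "iet_data D \<Longrightarrow> bot_pos D (bot_last D) = CARD('a)"
  unfolding iet_data_def bot_last_def by (blast intro: numbering_last)

text \<open>A letter that is last in both rows would leave the same letters in the first
  \<open>CARD('a) - 1\<close> positions of both, against admissibility.\<close>

lemma top_last_neq_bot_last:
  fixes D :: "'a::finite iet"
  assumes card: "CARD('a) \<ge> 2" and D: "iet_data D" and adm: "admissible D"
  shows "top_last D \<noteq> bot_last D"
proof
  assume eq: "top_last D = bot_last D"
  have vim: "p -` {1..CARD('a) - 1} = - {\<alpha>}"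
    if p: "numbering p" "p \<alpha> = CARD('a)" for p :: "'a \<Rightarrow> nat" and \<alpha>
  proof -
    have "p x \<in> {1..CARD('a) - 1} \<longleftrightarrow> x \<noteq> \<alpha>" for x
      using numbering_bounds[OF p(1), of x] numbering_inj[OF p(1), of x \<alpha>] p(2) card by auto
    then show ?thesis by (intro set_eqI) (simp only: vimage_eq Compl_iff singleton_iff)
  qed
  have "top_pos D -` {1..CARD('a) - 1} = bot_pos D -` {1..CARD('a) - 1}"
    using vim[of "top_pos D" "top_last D"] vim[of "bot_pos D" "bot_last D"] eq
      top_pos_top_last[OF D] bot_pos_bot_last[OF D] D
    by (simp add: iet_data_def)
  moreover have "CARD('a) - 1 \<in> {1..CARD('a) - 1}" using card by auto
  ultimately show False using adm unfolding admissible_def by blast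
qed

text \<open>If the last letters had equal length, the map would send the left endpoint of
  \<open>bot_last D\<close> to that of \<open>top_last D\<close>, which the Keane property forbids
  with \<open>m = 1\<close>.\<close>

lemma regular_types:
  fixes D :: "'a::finite iet"
  assumes "regular D"
  shows "top_type D \<or> bottom_type D"
proof (rule ccontr)
  assume "\<not> ?thesis"
  then have eq: "len D (top_last D) = len D (bot_last D)"
    by (auto simp: top_type_def bottom_type_def)
  have D: "iet_data D" and card: "CARD('a) \<ge> 2" using assms by (auto simp: regular_def)
  note T = iet_map_subinterval[OF D left_endpoint_in_subinterval[OF D, of "bot_last D"]]
  have "iet_map D (left_endpoint D (bot_last D)) = left_endpoint D (top_last D)"
    using D offset_last[of "bot_pos D" "bot_last D"] offset_last[of "top_pos D" "top_last D"]
      top_pos_top_last[OF D] bot_pos_bot_last[OF D] eq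
    unfolding T by (simp add: left_endpoint_eq_offset iet_data_def)
  then have "(iet_map D ^^ 1) (left_endpoint D (bot_last D)) = left_endpoint D (top_last D)"
    by simp
  moreover have "top_pos D (top_last D) > 1" using top_pos_top_last[OF D] card by simp
  ultimately show False
    using assms unfolding regular_def keane_def by blast
qed

context
  fixes D :: "'a::finite iet"
  assumes reg: "regular D"
begin

lemma regular_data: "iet_data D" "CARD('a) \<ge> 2" "admissible D" "keane D"
  using reg by (auto simp: regular_def)

lemma numbering_top: "numbering (top_pos D)" and numbering_bot: "numbering (bot_pos D)"
  and len_pos: "0 < len D x"
  using regular_data(1) by (auto simp: iet_data_def)

lemma numbering_win: "numbering (win_pos D)" and numbering_lose: "numbering (lose_pos D)"
  using numbering_top numbering_bot by (auto simp: win_pos_def lose_pos_def)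

lemma winner_neq_loser: "winner D \<noteq> loser D"
  using top_last_neq_bot_last[OF regular_data(2,1,3)] by (auto simp: winner_def loser_def)

lemma len_loser_less: "len D (loser D) < len D (winner D)"
  using regular_types[OF reg] by (auto simp: winner_def loser_def top_type_def bottom_type_def)

lemma win_pos_winner: "win_pos D (winner D) = CARD('a)"
  using top_pos_top_last[OF regular_data(1)] bot_pos_bot_last[OF regular_data(1)]
  by (simp add: win_pos_def winner_def)

lemma lose_pos_loser: "lose_pos D (loser D) = CARD('a)"
  using top_pos_top_last[OF regular_data(1)] bot_pos_bot_last[OF regular_data(1)]
  by (simp add: lose_pos_def loser_def)

lemma len_rv_step: "len (rv_step D) = (len D)(winner D := len D (winner D) - len D (loser D))"
  using regular_types[OF reg] by (auto simp: rv_step_def)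

lemma top_pos_rv_step:
  "top_pos (rv_step D) = (if top_type D then win_pos D else move_last_after (winner D) (lose_pos D))"
  using regular_types[OF reg] by (auto simp: rv_step_def winner_def win_pos_def lose_pos_def)

lemma bot_pos_rv_step:
  "bot_pos (rv_step D) = (if top_type D then move_last_after (winner D) (lose_pos D) else win_pos D)"
  using regular_types[OF reg] by (auto simp: rv_step_def winner_def win_pos_def lose_pos_def)

lemmas lose_move = numbering_lose lose_pos_loser winner_neq_loser

text \<open>Only the winner changes its length, and being last in this row it enters no
  offset.\<close>

lemma offset_win: "offset (win_pos D) (len (rv_step D)) \<xi> = offset (win_pos D) (len D) \<xi>"
proof (rule offset_cong)
  fix \<psi> assume "win_pos D \<psi> < win_pos D \<xi>"
  then have "\<psi> \<noteq> winner D"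
    using win_pos_winner numbering_bounds(2)[OF numbering_win, of \<xi>] by auto
  then show "len (rv_step D) \<psi> = len D \<psi>" by (simp add: len_rv_step)
qed

lemma offset_lose:
  "offset (move_last_after (winner D) (lose_pos D)) (len (rv_step D)) \<xi> =
     (if \<xi> = loser D
      then offset (lose_pos D) (len D) (winner D) + len D (winner D) - len D (loser D)
      else offset (lose_pos D) (len D) \<xi>)"
  using offset_move_last_after[OF lose_move, where l = "len D"] by (simp add: len_rv_step)

lemma iet_data_rv_step: "iet_data (rv_step D)"
proof -
  have "numbering (move_last_after (winner D) (lose_pos D))"
    using numbering_move_last_after[OF numbering_lose, of "winner D"]
      move_last_after_simps(4)[OF lose_move] lose_pos_loser by simp
  then show ?thesis
    using numbering_win len_pos len_loser_less
    by (auto simp: iet_data_def top_pos_rv_step bot_pos_rv_step len_rv_step)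
qed

text \<open>Up to the position of the winner in the rearranged row, the initial segments are the old
  ones. Longer proper segments of that row contain the winner, those of the other row do
  not.\<close>

lemma admissible_rv_step: "admissible (rv_step D)"
proof -
  have "win_pos D -` {1..k} \<noteq> move_last_after (winner D) (lose_pos D) -` {1..k}"
    if k: "k \<in> {1..CARD('a) - 1}" for k
  proof (cases "k < lose_pos D (winner D) + 1")
    case True
    have "move_last_after (winner D) (lose_pos D) \<xi> \<in> {1..k} \<longleftrightarrow> lose_pos D \<xi> \<in> {1..k}" for \<xi>
      using move_last_after_simps(1)[OF lose_move, of \<xi>] move_last_after_le_iff[OF lose_move, of \<xi>] True
      by (cases "lose_pos D \<xi> \<le> lose_pos D (winner D)") auto
    then have "move_last_after (winner D) (lose_pos D) -` {1..k} = lose_pos D -` {1..k}"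
      by auto
    moreover have "win_pos D -` {1..k} \<noteq> lose_pos D -` {1..k}"
      using regular_data(3) k unfolding admissible_def win_pos_def lose_pos_def
      by (metis (full_types))
    ultimately show ?thesis by simp
  next
    case False
    then have "winner D \<in> move_last_after (winner D) (lose_pos D) -` {1..k}"
      using move_last_after_simps(1)[OF lose_move, of "winner D"]
        numbering_bounds(1)[OF numbering_lose, of "winner D"] by simp
    moreover have "winner D \<notin> win_pos D -` {1..k}"
      using win_pos_winner k by auto
    ultimately show ?thesis by blast
  qed
  then show ?thesis
    unfolding admissible_def top_pos_rv_step bot_pos_rv_step by (metis (full_types))
qed

lemma total_length_rv_step: "total_length (rv_step D) = total_length D - len D (loser D)"
  by (simp add: total_length_def len_rv_step sum.remove[of UNIV "winner D"])

text \<open>The step keeps both offsets of \<open>\<xi>\<close> and can only shorten its interval,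
  so the translation is the old one.\<close>

lemma rv_step_subinterval:
  assumes x: "x \<in> subinterval (rv_step D) \<xi>" and \<xi>: "\<xi> \<noteq> loser D"
  shows "x \<in> subinterval D \<xi>" and "iet_map (rv_step D) x = iet_map D x"
proof -
  have top: "offset (top_pos (rv_step D)) (len (rv_step D)) \<xi> = offset (top_pos D) (len D) \<xi>"
    and bot: "offset (bot_pos (rv_step D)) (len (rv_step D)) \<xi> = offset (bot_pos D) (len D) \<xi>"
    using \<xi> by (simp_all add: top_pos_rv_step bot_pos_rv_step offset_win offset_lose)
      (simp_all add: win_pos_def lose_pos_def)
  have "len (rv_step D) \<xi> \<le> len D \<xi>"
    using len_pos[of "loser D"] by (simp add: len_rv_step)
  then show in_sub: "x \<in> subinterval D \<xi>"
    using x by (auto simp: subinterval_def left_endpoint_eq_offset top)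
  show "iet_map (rv_step D) x = iet_map D x"
    by (simp add: iet_map_subinterval[OF iet_data_rv_step x]
        iet_map_subinterval[OF regular_data(1) in_sub] top bot)
qed

text \<open>The order in which the orbit visits the old subintervals of winner and loser depends on the
  type of the step, hence the unordered pair.\<close>

lemma rv_step_subinterval_loser:
  assumes x: "x \<in> subinterval (rv_step D) (loser D)"
  obtains \<phi> \<psi> where "x \<in> subinterval D \<phi>" "iet_map D x \<in> subinterval D \<psi>"
    "{\<phi>, \<psi>} = {winner D, loser D}" "\<phi> \<noteq> \<psi>"
    "iet_map (rv_step D) x = iet_map D (iet_map D x)"
proof -
  let ?\<alpha> = "winner D" and ?\<beta> = "loser D" and ?l = "len D"
  note T = iet_map_subinterval[OF regular_data(1)]
  note T' = iet_map_subinterval[OF iet_data_rv_step x]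
  have win: "offset (win_pos D) ?l ?\<alpha> = sum ?l UNIV - ?l ?\<alpha>"
    by (rule offset_last[OF numbering_win win_pos_winner])
  have lose: "offset (lose_pos D) ?l ?\<beta> = sum ?l UNIV - ?l ?\<beta>"
    by (rule offset_last[OF numbering_lose lose_pos_loser])
  have len': "len (rv_step D) ?\<beta> = ?l ?\<beta>" using winner_neq_loser by (simp add: len_rv_step)
  show thesis
  proof (cases "top_type D")
    case True
    note pos = win_pos_def lose_pos_def
    \<comment> \<open>Top type: the interval of the loser is unchanged, and its image is the right
      end of the whole interval, hence inside the longer interval of the winner.\<close>
    have 1: "x \<in> subinterval D ?\<beta>"
      using x True offset_win[of ?\<beta>]
      by (simp add: subinterval_def left_endpoint_eq_offset top_pos_rv_step len' pos)
    have 2: "iet_map D x \<in> subinterval D ?\<alpha>"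
      using True 1 win lose len_loser_less
      by (simp add: T[OF 1] subinterval_def left_endpoint_eq_offset pos)
    have "iet_map (rv_step D) x = iet_map D (iet_map D x)"
      using True win lose offset_win[of ?\<beta>] offset_lose[of ?\<beta>]
      unfolding T[OF 2] T' unfolding T[OF 1]
      by (simp add: top_pos_rv_step bot_pos_rv_step pos)
    then show thesis by (intro that[OF 1 2]) (use winner_neq_loser in auto)
  next
    case False
    note pos = win_pos_def lose_pos_def
    \<comment> \<open>Bottom type: the new interval of the loser is the right end of the old one of
      the winner, and its image is the old interval of the loser.\<close>
    have 1: "x \<in> subinterval D ?\<alpha>"
      using x False offset_lose[of ?\<beta>] len_loser_less
      by (simp add: subinterval_def left_endpoint_eq_offset top_pos_rv_step len' pos)
    have 2: "iet_map D x \<in> subinterval D ?\<beta>"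
      using False x win lose offset_lose[of ?\<beta>]
      by (simp add: T[OF 1] subinterval_def left_endpoint_eq_offset top_pos_rv_step len' pos)
    have "iet_map (rv_step D) x = iet_map D (iet_map D x)"
      using False win lose offset_win[of ?\<beta>] offset_lose[of ?\<beta>]
      unfolding T[OF 2] T' unfolding T[OF 1]
      by (simp add: top_pos_rv_step bot_pos_rv_step pos)
    then show thesis by (intro that[OF 1 2]) (use winner_neq_loser in auto)
  qed
qed

section \<open>Transfer of the Keane property to the new data\<close>

lemma rv_step_iterate:
  assumes "x \<in> {0..<total_length (rv_step D)}"
  shows "\<exists>m'\<ge>m. (iet_map (rv_step D) ^^ m) x = (iet_map D ^^ m') x"
proof (induction m)
  case 0
  show ?case by (intro exI[of _ 0]) simp
next
  case (Suc m)
  then obtain m' where m': "m' \<ge> m" "(iet_map (rv_step D) ^^ m) x = (iet_map D ^^ m') x" by auto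
  define y where "y = (iet_map (rv_step D) ^^ m) x"
  have "y \<in> {0..<total_length (rv_step D)}"
    unfolding y_def by (induction m) (use assms iet_map_in[OF iet_data_rv_step] in auto)
  then obtain \<xi> where \<xi>: "y \<in> subinterval (rv_step D) \<xi>"
    using ex_subinterval[OF iet_data_rv_step] by blast
  \<comment> \<open>One new iterate costs two old ones on the interval of the loser and one
    elsewhere; since it is never zero, \<open>m' \<ge> m\<close> survives and positive exponents
    stay positive.\<close>
  have "\<exists>j\<ge>1. iet_map (rv_step D) y = (iet_map D ^^ j) y"
  proof (cases "\<xi> = loser D")
    case True
    with \<xi> have "iet_map (rv_step D) y = (iet_map D ^^ 2) y"
      by (auto elim: rv_step_subinterval_loser simp: numeral_2_eq_2)
    then show ?thesis by (intro exI[of _ 2]) auto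
  next
    case False
    with \<xi> have "iet_map (rv_step D) y = (iet_map D ^^ 1) y"
      by (simp add: rv_step_subinterval)
    then show ?thesis by blast
  qed
  then obtain j where j: "j \<ge> 1" "iet_map (rv_step D) y = (iet_map D ^^ j) y" by auto
  have "(iet_map (rv_step D) ^^ Suc m) x = (iet_map D ^^ (j + m')) x"
    using j(2) m'(2) by (simp add: y_def funpow_add)
  then show ?case using j(1) m'(1) by (intro exI[of _ "j + m'"]) auto
qed

text \<open>An endpoint can move only for the loser of a bottom step, and then the new endpoint is a
  preimage of the old one.\<close>

lemma left_endpoint_rv_step:
  "left_endpoint (rv_step D) \<xi> = left_endpoint D \<xi> \<or>
   \<xi> = loser D \<and> top_pos D \<xi> = CARD('a) \<and>
     iet_map D (left_endpoint (rv_step D) \<xi>) = left_endpoint D \<xi>"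
proof (cases "top_type D \<or> \<xi> \<noteq> loser D")
  case True
  then show ?thesis
    by (auto simp: left_endpoint_eq_offset top_pos_rv_step offset_win offset_lose)
      (auto simp: win_pos_def lose_pos_def)
next
  case False
  let ?\<alpha> = "winner D" and ?\<beta> = "loser D" and ?l = "len D"
  have F: "\<not> top_type D" "\<xi> = ?\<beta>" using False by auto
  have le: "left_endpoint (rv_step D) ?\<beta> = offset (top_pos D) ?l ?\<alpha> + ?l ?\<alpha> - ?l ?\<beta>"
    using F offset_lose[of ?\<beta>]
    by (simp add: left_endpoint_eq_offset top_pos_rv_step lose_pos_def)
  have 1: "left_endpoint (rv_step D) ?\<beta> \<in> subinterval D ?\<alpha>"
    using len_loser_less len_pos[of ?\<beta>]
    unfolding subinterval_def le by (simp add: left_endpoint_eq_offset)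
  have "offset (win_pos D) ?l ?\<alpha> = sum ?l UNIV - ?l ?\<alpha>"
    "offset (lose_pos D) ?l ?\<beta> = sum ?l UNIV - ?l ?\<beta>"
    using offset_last[OF numbering_win win_pos_winner] offset_last[OF numbering_lose lose_pos_loser]
    by auto
  then have "iet_map D (left_endpoint (rv_step D) ?\<beta>) = left_endpoint D ?\<beta>"
    using F unfolding iet_map_subinterval[OF regular_data(1) 1] unfolding le
    by (simp add: left_endpoint_eq_offset win_pos_def lose_pos_def)
  then show ?thesis using F lose_pos_loser by (simp add: lose_pos_def)
qed

text \<open>A connection of the new map becomes one of the old map: append an iterate if the
  endpoint of the target moved, drop the first iterate if that of the source moved.\<close>

lemma keane_rv_step: "keane (rv_step D)"
  unfolding keane_def
proof (intro notI, elim exE conjE)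
  fix \<alpha> \<beta> m
  assume m: "m \<ge> 1" and pos: "top_pos (rv_step D) \<beta> > 1"
    and eq: "(iet_map (rv_step D) ^^ m) (left_endpoint (rv_step D) \<alpha>) = left_endpoint (rv_step D) \<beta>"
  let ?T = "iet_map D" and ?p = "left_endpoint D" and ?p' = "left_endpoint (rv_step D)"
  obtain m' where m': "m' \<ge> 1" "(?T ^^ m') (?p' \<alpha>) = ?p' \<beta>"
    using rv_step_iterate[OF left_endpoint_in[OF iet_data_rv_step, of \<alpha>], of m] m eq
    by (metis order_trans)
  have keane: "False" if "k \<ge> 1" "(?T ^^ k) (?p \<phi>) = ?p \<psi>" "top_pos D \<psi> > 1" for k \<phi> \<psi>
    using that regular_data(4) unfolding keane_def by blast
  have "top_pos D \<beta> \<noteq> 1"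
  proof
    assume 1: "top_pos D \<beta> = 1"
    then have "top_pos (rv_step D) \<beta> = 1"
      using numbering_bounds(1)[OF numbering_lose, of "winner D"]
      by (simp add: top_pos_rv_step win_pos_def lose_pos_def move_last_after_def split: if_splits)
    then show False using pos by simp
  qed
  then have pos\<beta>: "top_pos D \<beta> > 1"
    using numbering_bounds(1)[OF numbering_top, of \<beta>] by simp
  obtain k where k: "k \<ge> m'" "(?T ^^ k) (?p' \<alpha>) = ?p \<beta>" "?p' \<beta> = ?p \<beta> \<Longrightarrow> k = m'"
    "?p' \<beta> \<noteq> ?p \<beta> \<Longrightarrow> k = Suc m'"
    using left_endpoint_rv_step[of \<beta>] m'(2)
    by (cases "?p' \<beta> = ?p \<beta>") (auto intro: that[of "Suc m'"] that[of m'])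
  show False
  proof (cases "?p' \<alpha> = ?p \<alpha>")
    case True
    then show False using keane[of k \<alpha> \<beta>] k m' pos\<beta> by auto
  next
    case False
    then have \<alpha>: "\<alpha> = loser D" "?T (?p' \<alpha>) = ?p \<alpha>" using left_endpoint_rv_step[of \<alpha>] by auto
    obtain j where j: "k = Suc j" using k(1) m'(1) by (cases k) auto
    have Tj: "(?T ^^ j) (?p \<alpha>) = ?p \<beta>"
      using k(2) \<alpha>(2) by (simp add: j funpow_Suc_right del: funpow.simps)
    show False
    proof (cases j)
      case 0
      \<comment> \<open>If nothing remains after dropping an iterate, source and target coincide.
        Then an iterate was also appended, so \<open>k \<ge> 2\<close>, against
        \<open>k = 1\<close>.\<close>
      then have "\<alpha> = \<beta>"
        using Tj offset_inj[of "top_pos D" "len D" \<alpha> \<beta>, OF numbering_top len_pos]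
        by (simp add: left_endpoint_eq_offset)
      then have "k = Suc m'" using k(4) False by simp
      then show False using j 0 m'(1) by simp
    next
      case (Suc i)
      then show False using keane[of j \<alpha> \<beta>] Tj pos\<beta> by auto
    qed
  qed
qed

lemma regular_rv_step: "regular (rv_step D)"
  using iet_data_rv_step admissible_rv_step keane_rv_step regular_data(2) by (simp add: regular_def)

section \<open>Translation of the winner, and steps that keep the winner\<close>

lemma shift_eq: "shift D = total_length D - len D (winner D) - offset (lose_pos D) (len D) (winner D)"
  using sum_eq_offset[OF numbering_lose, of "len D" "winner D"]
  by (simp add: shift_def total_length_def)

lemma shift_pos: "0 < shift D"
  unfolding shift_def
  by (rule sum_pos2[of _ "loser D"])
    (use move_last_after_simps(4)[OF lose_move] len_pos in \<open>auto intro: less_imp_le\<close>)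

text \<open>The winner ends one row, and in the other exactly the length \<open>shift D\<close> lies
  behind it; the type of the step decides only the sign.\<close>

lemma iet_map_winner:
  assumes "x \<in> subinterval D (winner D)"
  shows "\<bar>iet_map D x - x\<bar> = shift D"
proof -
  have "offset (win_pos D) (len D) (winner D) = total_length D - len D (winner D)"
    unfolding total_length_def by (rule offset_last[OF numbering_win win_pos_winner])
  then show ?thesis
    using shift_pos unfolding iet_map_subinterval[OF regular_data(1) assms]
    by (simp add: shift_eq win_pos_def lose_pos_def split: if_splits)
qed

lemma potential_le: "potential D \<le> CARD('a) * len D (winner D)"
proof -
  have "0 \<le> (\<Sum>\<xi> | lose_pos D (winner D) < lose_pos D \<xi>.
      (real (lose_pos D \<xi>) - real (lose_pos D (winner D))) * len D \<xi>)"
    by (rule sum_nonneg) (use len_pos in \<open>auto intro: less_imp_le\<close>)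
  moreover have "(real CARD('a) - real (lose_pos D (winner D))) * len D (winner D)
      \<le> CARD('a) * len D (winner D)"
    by (rule mult_right_mono) (use len_pos in \<open>auto intro: less_imp_le\<close>)
  ultimately show ?thesis by (simp add: potential_def)
qed

text \<open>The first term is nonnegative and every weight in the sum is at most
  \<open>CARD('a)\<close>. With \<open>potential_le\<close> this limits how often the potential can
  drop by a fixed \<open>shift D\<close>.\<close>

lemma potential_ge: "- (CARD('a) * shift D) \<le> potential D"
proof -
  have "(\<Sum>\<xi> | lose_pos D (winner D) < lose_pos D \<xi>.
      (real (lose_pos D \<xi>) - real (lose_pos D (winner D))) * len D \<xi>) \<le> CARD('a) * shift D"
    unfolding shift_def sum_distrib_left
  proof (intro sum_mono mult_right_mono)
    fix \<xi>
    show "real (lose_pos D \<xi>) - real (lose_pos D (winner D)) \<le> real CARD('a)"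
      using numbering_bounds(2)[OF numbering_lose, of \<xi>] by linarith
    show "0 \<le> len D \<xi>" using len_pos by (auto intro: less_imp_le)
  qed
  moreover have "0 \<le> (real CARD('a) - real (lose_pos D (winner D))) * len D (winner D)"
    using numbering_bounds(2)[OF numbering_lose, of "winner D"] len_pos[of "winner D"] by simp
  ultimately show ?thesis by (simp add: potential_def)
qed

lemma same_winner_step:
  assumes same: "winner (rv_step D) = winner D"
  shows "shift (rv_step D) = shift D" and "potential (rv_step D) = potential D - shift D"
proof -
  let ?\<alpha> = "winner D" and ?\<beta> = "loser D" and ?p = "lose_pos D" and ?l = "len D"
  let ?p' = "move_last_after ?\<alpha> ?p"
  let ?S = "{\<xi>. ?p ?\<alpha> < ?p \<xi>}"
  have neq: "top_last (rv_step D) \<noteq> bot_last (rv_step D)"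
    using top_last_neq_bot_last regular_rv_step by (auto simp: regular_def)
  have "top_pos (rv_step D) = top_pos D \<Longrightarrow> top_last (rv_step D) = top_last D"
    "bot_pos (rv_step D) = bot_pos D \<Longrightarrow> bot_last (rv_step D) = bot_last D"
    by (simp_all add: top_last_def bot_last_def)
  \<comment> \<open>The kept row still ends with the old winner. A change of type would make the
    same letter end the other row too, contradicting \<open>neq\<close>.\<close>
  then have "top_type (rv_step D) \<longleftrightarrow> top_type D"
    using same neq top_pos_rv_step bot_pos_rv_step
    by (auto simp: winner_def win_pos_def split: if_splits)
  then have p': "lose_pos (rv_step D) = ?p'"
    by (simp add: lose_pos_def top_pos_rv_step bot_pos_rv_step)
  have a: "?p' ?\<alpha> = ?p ?\<alpha>" by (simp add: move_last_after_def)
  have S: "{\<xi>. ?p' ?\<alpha> < ?p' \<xi>} = ?S"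
    using move_last_after_le_iff[OF lose_move] unfolding a by (auto simp: not_le[symmetric])
  show "shift (rv_step D) = shift D"
    unfolding shift_def same p' S by (rule sum.cong) (auto simp: len_rv_step)
  \<comment> \<open>All weights are raised by one, including that of the loser; the last term
    corrects its weight down to \<open>1\<close> and later cancels against the length lost by the
    winner.\<close>
  have "(\<Sum>\<xi>\<in>?S. (real (?p' \<xi>) - real (?p ?\<alpha>)) * len (rv_step D) \<xi>) =
    (\<Sum>\<xi>\<in>?S. (real (?p \<xi>) - real (?p ?\<alpha>)) * ?l \<xi> + ?l \<xi>
      - (if \<xi> = ?\<beta> then (real CARD('a) - real (?p ?\<alpha>)) * ?l ?\<beta> else 0))"
  proof (rule sum.cong[OF refl])
    fix \<xi> assume "\<xi> \<in> ?S"
    then have lt: "?p ?\<alpha> < ?p \<xi>" and "\<xi> \<noteq> ?\<alpha>" by auto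
    then have l: "len (rv_step D) \<xi> = ?l \<xi>" by (simp add: len_rv_step)
    show "(real (?p' \<xi>) - real (?p ?\<alpha>)) * len (rv_step D) \<xi> =
      (real (?p \<xi>) - real (?p ?\<alpha>)) * ?l \<xi> + ?l \<xi>
      - (if \<xi> = ?\<beta> then (real CARD('a) - real (?p ?\<alpha>)) * ?l ?\<beta> else 0)"
      using move_last_after_simps(2)[OF lose_move] move_last_after_simps(3)[OF lose_move lt]
        lose_pos_loser unfolding l
      by (cases "\<xi> = ?\<beta>") (auto simp: algebra_simps)
  qed
  also have "\<dots> = (\<Sum>\<xi>\<in>?S. (real (?p \<xi>) - real (?p ?\<alpha>)) * ?l \<xi>) + shift D
      - (real CARD('a) - real (?p ?\<alpha>)) * ?l ?\<beta>"
    using move_last_after_simps(4)[OF lose_move]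
    by (simp add: sum.distrib sum_subtractf shift_def)
  finally show "potential (rv_step D) = potential D - shift D"
    unfolding potential_def same p' a S[unfolded a]
    by (simp add: len_rv_step algebra_simps)
qed

end

subsection \<open>Heights and matrix norms\<close>

lemma rv_iter_simps [simp]: "rv_iter D 0 = D" "rv_iter D (Suc n) = rv_step (rv_iter D n)"
  by (simp_all add: rv_iter_def)

lemma regular_rv_iter: "regular D \<Longrightarrow> regular (rv_iter D n)"
  by (induction n) (auto intro: regular_rv_step)

text \<open>The tower heights: \<open>iet_map_rv_iter\<close> identifies them as exponents of the
  original map, \<open>row_sum_rv_mat\<close> as row sums of \<open>Q(0,n)\<close>.\<close>

primrec height :: "('a::finite) iet \<Rightarrow> nat \<Rightarrow> 'a \<Rightarrow> nat" where
  "height D 0 = (\<lambda>\<xi>. 1)"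
| "height D (Suc n) =
     (let \<alpha> = winner (rv_iter D n); \<beta> = loser (rv_iter D n)
      in (height D n)(\<beta> := height D n \<beta> + height D n \<alpha>))"

lemma height_pos: "1 \<le> height D n \<xi>"
  by (induction n arbitrary: \<xi>) (auto simp: Let_def trans_le_add1)

text \<open>A point of the new interval of the loser crosses the old intervals of winner and loser
  once each, so the two exponents add up as in the recursion for \<open>height\<close>.\<close>

lemma iet_map_rv_iter:
  assumes "regular D" "x \<in> subinterval (rv_iter D n) \<xi>"
  shows "iet_map (rv_iter D n) x = (iet_map D ^^ height D n \<xi>) x"
  using assms(2)
proof (induction n arbitrary: x \<xi>)
  case (Suc n)
  let ?E = "rv_iter D n"
  have E: "regular ?E" using assms(1) by (rule regular_rv_iter)
  show ?case
  proof (cases "\<xi> = loser ?E")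
    case True
    with Suc.prems have "x \<in> subinterval (rv_step ?E) (loser ?E)" by simp
    then obtain \<phi> \<psi> where *: "x \<in> subinterval ?E \<phi>" "iet_map ?E x \<in> subinterval ?E \<psi>"
      "{\<phi>, \<psi>} = {winner ?E, loser ?E}" "\<phi> \<noteq> \<psi>"
      "iet_map (rv_step ?E) x = iet_map ?E (iet_map ?E x)"
      using rv_step_subinterval_loser[OF E] by metis
    have "height D n \<psi> + height D n \<phi> = height D (Suc n) \<xi>"
      using *(3,4) True by (auto simp: Let_def doubleton_eq_iff)
    moreover have "iet_map (rv_step ?E) x = (iet_map D ^^ (height D n \<psi> + height D n \<phi>)) x"
      using Suc.IH[OF *(2)] Suc.IH[OF *(1)] *(5) by (simp add: funpow_add)
    ultimately show ?thesis by simp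
  next
    case False
    then show ?thesis
      using rv_step_subinterval[OF E, of x \<xi>] Suc.prems Suc.IH[of x \<xi>] by (simp add: Let_def)
  qed
qed simp

text \<open>The total area of the towers is invariant: a step moves the area
  \<open>len \<beta> * height \<alpha>\<close> from the winner \<open>\<alpha>\<close> to the loser
  \<open>\<beta>\<close>.\<close>

lemma sum_len_height:
  assumes "regular D"
  shows "(\<Sum>\<xi>\<in>UNIV. len (rv_iter D n) \<xi> * height D n \<xi>) = total_length D"
proof (induction n)
  case (Suc n)
  let ?E = "rv_iter D n"
  have E: "regular ?E" using assms(1) by (rule regular_rv_iter)
  let ?\<alpha> = "winner ?E" and ?\<beta> = "loser ?E"
  have "len (rv_step ?E) \<xi> * height D (Suc n) \<xi> = len ?E \<xi> * height D n \<xi>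
      + (if \<xi> = ?\<beta> then len ?E ?\<beta> * height D n ?\<alpha> else 0)
      - (if \<xi> = ?\<alpha> then len ?E ?\<beta> * height D n ?\<alpha> else 0)" for \<xi>
    using winner_neq_loser[OF E] by (auto simp: len_rv_step[OF E] Let_def algebra_simps)
  then show ?case using Suc by (simp add: sum.distrib sum_subtractf)
qed (simp add: total_length_def)

section \<open>Step matrices as row operations\<close>

lemma step_mat_mult:
  "(step_mat D ** A) $ i $ j = A $ i $ j + (if i = loser D then A $ winner D $ j else 0)"
proof -
  have "(step_mat D ** A) $ i $ j = (\<Sum>k\<in>UNIV. (if k = i then A $ k $ j else 0) +
      (if k = winner D then (if i = loser D then A $ k $ j else 0) else 0))"
    unfolding step_mat_def matrix_matrix_mult_def elem_mat_def mat_def vec_lambda_beta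
      vector_add_component
    by (rule sum.cong) auto
  then show ?thesis by (simp add: sum.distrib)
qed

lemma rv_mat_0_Suc: "rv_mat D 0 (Suc n) = step_mat (rv_iter D n) ** rv_mat D 0 n"
  by simp

lemma row_sum_rv_mat: "(\<Sum>j\<in>UNIV. rv_mat D 0 n $ i $ j) = height D n i"
proof (induction n arbitrary: i)
  case 0
  show ?case by (simp add: mat_def)
next
  case (Suc n)
  then show ?case
    unfolding rv_mat_0_Suc step_mat_mult by (auto simp: sum.distrib Let_def)
qed

lemma height_le_mat_norm: "height D n i \<le> mat_norm (rv_mat D 0 n)"
proof -
  have "height D n i \<le> (\<Sum>j\<in>UNIV. \<bar>rv_mat D 0 n $ i $ j\<bar>)"
    unfolding row_sum_rv_mat[symmetric] by (rule sum_mono) simp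
  also have "\<dots> \<le> mat_norm (rv_mat D 0 n)"
    unfolding mat_norm_def by (rule member_le_sum) (auto intro: sum_nonneg)
  finally show ?thesis .
qed

text \<open>The constant winner never loses, so its row stays a unit vector; each step adds this
  row, of sum \<open>1\<close>, to another one. The claim on the row is what carries the
  induction.\<close>

lemma rv_mat_same_winner:
  fixes D :: "'a::finite iet"
  assumes "regular D" "\<And>i. i < N \<Longrightarrow> winner (rv_iter D (n + i)) = \<alpha>"
  shows "rv_mat D n (n + N) $ \<alpha> = mat 1 $ \<alpha> \<and> mat_norm (rv_mat D n (n + N)) \<le> CARD('a) + N"
  using assms(2)
proof (induction N)
  case 0
  have "rv_mat D n n = mat 1" by (cases n) auto
  moreover have "mat_norm (mat 1 :: real^'a^'a) = CARD('a)"
    by (simp add: mat_norm_def mat_def if_distrib cong: if_cong)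
  ultimately show ?case by simp
next
  case (Suc N)
  let ?E = "rv_iter D (n + N)" and ?A = "rv_mat D n (n + N)"
  have w: "winner ?E = \<alpha>" using Suc.prems by simp
  have l: "loser ?E \<noteq> \<alpha>" using winner_neq_loser[OF regular_rv_iter[OF assms(1)], of "n + N"] w by simp
  have A: "?A $ \<alpha> = mat 1 $ \<alpha>" "mat_norm ?A \<le> CARD('a) + N" using Suc by auto
  have eq: "rv_mat D n (n + Suc N) = step_mat ?E ** ?A" by simp
  have "mat_norm (step_mat ?E ** ?A) \<le>
    (\<Sum>i\<in>UNIV. \<Sum>j\<in>UNIV. \<bar>?A $ i $ j\<bar> + (if i = loser ?E then \<bar>?A $ \<alpha> $ j\<bar> else 0))"
    unfolding mat_norm_def step_mat_mult w by (intro sum_mono) auto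
  also have "\<dots> = mat_norm ?A +
      (\<Sum>i\<in>UNIV. if i = loser ?E then (\<Sum>j\<in>UNIV. \<bar>?A $ \<alpha> $ j\<bar>) else 0)"
    unfolding mat_norm_def sum.distrib by (intro arg_cong2[of _ _ _ _ "(+)"] sum.cong) auto
  also have "\<dots> = mat_norm ?A + (\<Sum>j\<in>UNIV. \<bar>?A $ \<alpha> $ j\<bar>)"
    by simp
  also have "(\<Sum>j\<in>UNIV. \<bar>?A $ \<alpha> $ j\<bar>) = 1"
    unfolding A(1) by (simp add: mat_def if_distrib cong: if_cong)
  finally have "mat_norm (step_mat ?E ** ?A) \<le> CARD('a) + Suc N" using A(2) by simp
  moreover have "(step_mat ?E ** ?A) $ \<alpha> = mat 1 $ \<alpha>"
    using l A(1) by (simp add: vec_eq_iff step_mat_mult)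
  ultimately show ?case unfolding eq by blast
qed

text \<open>Under a constant winner \<open>shift\<close> is fixed and \<open>potential\<close> falls
  by it at every step, from at most \<open>CARD('a) * len E (winner E)\<close> to no less than
  \<open>- CARD('a) * shift E\<close>.\<close>

lemma same_winner_count:
  fixes D :: "'a::finite iet" and n N :: nat
  assumes D: "regular D" and same: "\<And>i. i < N \<Longrightarrow> winner (rv_iter D (n + i)) = \<alpha>"
  defines "E \<equiv> rv_iter D n"
  shows "N \<le> 1 + CARD('a) + CARD('a) * (len E (winner E) / shift E)"
proof (cases N)
  \<comment> \<open>\<open>N\<close> steps with a common winner give \<open>N - 1\<close>
    transitions between such data; this is the source of the summand \<open>1\<close>.\<close>
  case (Suc M)
  have E: "regular E" unfolding E_def by (rule regular_rv_iter[OF D])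
  have "shift (rv_iter D (n + i)) = shift E \<and> potential (rv_iter D (n + i)) = potential E - i * shift E"
    if "i < N" for i
    using that
  proof (induction i)
    case (Suc i)
    then have "winner (rv_step (rv_iter D (n + i))) = winner (rv_iter D (n + i))"
      using same[of i] same[of "Suc i"] by simp
    from same_winner_step[OF regular_rv_iter[OF D] this] Suc
    show ?case by (simp add: algebra_simps)
  qed (simp add: E_def)
  then have "shift (rv_iter D (n + M)) = shift E" "potential (rv_iter D (n + M)) = potential E - M * shift E"
    using Suc by auto
  then have "- (CARD('a) * shift E) \<le> potential E - M * shift E"
    using potential_ge[OF regular_rv_iter[OF D], of "n + M"] by simp
  then have "M * shift E \<le> CARD('a) * shift E + CARD('a) * len E (winner E)"
    using potential_le[OF E] by simp
  then have "real M \<le> CARD('a) + CARD('a) * (len E (winner E) / shift E)"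
    using shift_pos[OF E] by (simp add: field_simps)
  then show ?thesis using Suc by simp
next
  case 0
  have E: "regular E" unfolding E_def by (rule regular_rv_iter[OF D])
  show ?thesis using 0 shift_pos[OF E] len_pos[OF E, of "winner E"] by simp
qed

subsection \<open>Condition (U) and the length of Zorich steps\<close>

text \<open>A return within \<open>r\<close> at time \<open>j\<close> forces \<open>j\<close> to be
  at least the return time, which Condition (U) bounds below by a power of \<open>1 / r\<close>,
  uniformly in \<open>x\<close>.\<close>

lemma condition_U_displacement:
  assumes U: "condition_U D" and \<epsilon>: "\<epsilon> > 0"
  obtains r0 where "0 < r0"
    "\<And>r x j. 0 < r \<Longrightarrow> r < r0 \<Longrightarrow> x \<in> {0..<1} \<Longrightarrow> 1 \<le> j \<Longrightarrow> \<bar>(iet_map D ^^ j) x - x\<bar> < r \<Longrightarrow>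
       real j powr - (1 + \<epsilon>) \<le> r"
proof -
  \<comment> \<open>Chosen so that the exponent \<open>1 - \<delta>\<close> inverts to
    \<open>1 + \<epsilon>\<close>.\<close>
  define \<delta> where "\<delta> = \<epsilon> / (1 + \<epsilon>)"
  have \<delta>: "\<delta> > 0" "1 - \<delta> = 1 / (1 + \<epsilon>)" using \<epsilon> by (auto simp: \<delta>_def field_simps)
  have "\<forall>\<^sub>F r in at_right 0. \<forall>x\<in>{0..<1}. dist (ln (real (return_time D r x)) / (- ln r)) 1 < \<delta>"
    using U \<delta>(1) unfolding condition_U_def by (rule uniform_limitD)
  then obtain b where b: "b > 0"
    "\<And>r x. 0 < r \<Longrightarrow> r < b \<Longrightarrow> x \<in> {0..<1} \<Longrightarrow>
       dist (ln (real (return_time D r x)) / (- ln r)) 1 < \<delta>"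
    by (auto simp: eventually_at_right_field)
  show thesis
  \<comment> \<open>The bound \<open>1\<close> keeps \<open>- ln r\<close> positive, as needed to
    clear the denominator.\<close>
  proof (rule that[of "min b 1"])
    fix r x :: real and j :: nat
    assume r: "0 < r" "r < min b 1" and x: "x \<in> {0..<1}" and j: "1 \<le> j"
      and close: "\<bar>(iet_map D ^^ j) x - x\<bar> < r"
    let ?\<tau> = "return_time D r x"
    have j': "1 \<le> j \<and> \<bar>(iet_map D ^^ j) x - x\<bar> < r" using j close by simp
    have "1 \<le> ?\<tau>" "?\<tau> \<le> j"
      using LeastI[of "\<lambda>j. 1 \<le> j \<and> \<bar>(iet_map D ^^ j) x - x\<bar> < r", OF j']
        Least_le[of "\<lambda>j. 1 \<le> j \<and> \<bar>(iet_map D ^^ j) x - x\<bar> < r", OF j']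
      unfolding return_time_def by auto
    then have ln_le: "ln (real ?\<tau>) \<le> ln (real j)" by simp
    have neg: "0 < - ln r" using r by simp
    have "1 / (1 + \<epsilon>) < ln (real ?\<tau>) / (- ln r)"
      using b(2)[OF r(1) _ x] r(2) \<delta>(2) by (simp add: dist_real_def abs_less_iff)
    then have "- ln r / (1 + \<epsilon>) < ln (real ?\<tau>)"
      unfolding pos_less_divide_eq[OF neg] by simp
    then have "- ln r / (1 + \<epsilon>) < ln (real j)" using ln_le by linarith
    then have "- (1 + \<epsilon>) * ln (real j) \<le> ln r"
      using \<epsilon> by (simp add: field_simps)
    then have "exp (- (1 + \<epsilon>) * ln (real j)) \<le> r"
      using r(1) by (metis exp_le_cancel_iff exp_ln)
    then show "real j powr - (1 + \<epsilon>) \<le> r" using j by (simp add: powr_def)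
  qed (use b in auto)
qed

text \<open>The first summand covers a large shift, where \<open>len E (winner E) \<le> 1\<close>
  suffices. For a small shift, \<open>disp\<close> bounds it below in terms of \<open>R\<close>,
  while the area identity gives a length of at most \<open>1 / R\<close>.\<close>

lemma winner_len_over_shift:
  fixes D :: "'a::finite iet" and n :: nat
  assumes D: "regular D" and total: "total_length D = 1" and r0: "0 < r0"
    and disp: "\<And>r x j. 0 < r \<Longrightarrow> r < r0 \<Longrightarrow> x \<in> {0..<1} \<Longrightarrow> 1 \<le> j \<Longrightarrow>
       \<bar>(iet_map D ^^ j) x - x\<bar> < r \<Longrightarrow> real j powr - (1 + \<epsilon>) \<le> r"
  defines "E \<equiv> rv_iter D n"
  defines "R \<equiv> height D n (winner E)"
  shows "len E (winner E) / shift E \<le> 2 / r0 + 2 * R powr \<epsilon>"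
proof -
  let ?\<alpha> = "winner E" and ?W = "shift E"
  have E: "regular E" unfolding E_def by (rule regular_rv_iter[OF D])
  have R: "1 \<le> R" unfolding R_def by (rule height_pos)
  have "len E ?\<alpha> * R \<le> (\<Sum>\<xi>\<in>UNIV. len E \<xi> * height D n \<xi>)"
    unfolding R_def
    by (rule member_le_sum[of ?\<alpha>])
      (simp_all add: len_pos[OF E] less_imp_le)
  also have "\<dots> = 1" using sum_len_height[OF D, of n] total by (simp add: E_def)
  finally have lenR: "len E ?\<alpha> * R \<le> 1" .
  have W: "0 < ?W" by (rule shift_pos[OF E])
  show ?thesis
  \<comment> \<open>\<open>disp\<close> needs a displacement strictly below \<open>r\<close>, and
    the displacement is exactly \<open>?W\<close>; hence \<open>r = 2 * ?W\<close>.\<close>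
  proof (cases "2 * ?W < r0")
    case True
    let ?x = "left_endpoint E ?\<alpha>"
    have x: "?x \<in> subinterval E ?\<alpha>"
      by (rule left_endpoint_in_subinterval[OF regular_data(1)[OF E]])
    have "total_length (rv_iter D m) \<le> 1" for m
    proof (induction m)
      case (Suc m)
      then show ?case
        using total_length_rv_step[OF regular_rv_iter[OF D, of m]]
          len_pos[OF regular_rv_iter[OF D, of m], of "loser (rv_iter D m)"] by simp
    qed (simp add: total)
    then have x1: "?x \<in> {0..<1}"
      using left_endpoint_in[OF regular_data(1)[OF E], of ?\<alpha>] E_def by (force intro: less_le_trans)
    have "\<bar>(iet_map D ^^ R) ?x - ?x\<bar> < 2 * ?W"
      using iet_map_winner[OF E x] iet_map_rv_iter[OF D, of ?x n ?\<alpha>] x W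
      by (simp add: E_def R_def)
    then have "R powr - (1 + \<epsilon>) \<le> 2 * ?W"
      using disp[OF _ True x1 R] W by simp
    \<comment> \<open>Multiplying the two bounds leaves \<open>R powr - \<epsilon>\<close>, since
      the factor \<open>R\<close> absorbs one power.\<close>
    then have "len E ?\<alpha> * R * (R powr - (1 + \<epsilon>)) \<le> 1 * (2 * ?W)"
      using lenR by (intro mult_mono) auto
    then have "len E ?\<alpha> * R powr - \<epsilon> \<le> 2 * ?W"
      using R powr_mult_base[of "real R" "- (1 + \<epsilon>)"] by (simp add: mult.assoc)
    then have "len E ?\<alpha> \<le> 2 * ?W * R powr \<epsilon>"
      using R by (simp add: powr_minus field_simps)
    then have "len E ?\<alpha> / ?W \<le> 2 * R powr \<epsilon>" using W by (simp add: field_simps)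
    then show ?thesis using r0 by (simp add: add_increasing)
  next
    case False
    have "len E ?\<alpha> \<le> len E ?\<alpha> * R"
      using R len_pos[OF E, of ?\<alpha>] by simp
    then have "len E ?\<alpha> / ?W \<le> 1 / (r0 / 2)"
      using lenR False W r0 by (intro frac_le) auto
    then show ?thesis by (simp add: add_increasing2)
  qed
qed

text \<open>\<open>GREATEST\<close> has its intended value only on a nonempty bounded set:
  \<open>Suc z\<close> belongs to it, and \<open>same_winner_count\<close> bounds it.\<close>

lemma zorich_time_Suc:
  fixes D :: "'a::finite iet" and k :: nat
  assumes D: "regular D"
  defines "z \<equiv> zorich_time D k"
  obtains N \<alpha> where "zorich_time D (Suc k) = z + N"
    "\<And>i. i < N \<Longrightarrow> winner (rv_iter D (z + i)) = \<alpha>"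
proof -
  define P where "P n \<longleftrightarrow> n > z \<and> (\<exists>\<alpha>. \<forall>i\<in>{z..<n}. winner (rv_iter D i) = \<alpha>)" for n
  let ?E = "rv_iter D z"
  let ?B = "1 + CARD('a) + CARD('a) * (len ?E (winner ?E) / shift ?E)"
  have "P (Suc z)" unfolding P_def by auto
  moreover have "n \<le> z + nat \<lfloor>?B\<rfloor>" if Pn: "P n" for n
  proof -
    obtain \<alpha> where "n > z" "\<forall>i\<in>{z..<n}. winner (rv_iter D i) = \<alpha>"
      using Pn unfolding P_def by blast
    then have "real (n - z) \<le> ?B"
      by (intro same_winner_count[OF D, of _ _ \<alpha>]) auto
    then have "n - z \<le> nat \<lfloor>?B\<rfloor>" by (rule le_nat_floor)
    then show ?thesis by linarith
  qed
  ultimately have "P (GREATEST n. P n)" by (rule GreatestI_nat)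
  then have P: "P (zorich_time D (Suc k))" by (simp add: P_def z_def)
  define n where "n = zorich_time D (Suc k)"
  obtain \<alpha> where "\<forall>i\<in>{z..<n}. winner (rv_iter D i) = \<alpha>" "z < n"
    using P unfolding P_def n_def by blast
  then show thesis by (intro that[of "n - z" \<alpha>, folded n_def]) auto
qed

theorem theorem6p2:
  fixes D :: "('a::finite) iet"
  assumes "CARD('a) \<ge> 2"
    and "iet_data D"
    and "admissible D"
    and "keane D"
    and "total_length D = 1"
    and "condition_U D"
  shows "condition_Z D"
  unfolding condition_Z_def
proof (intro allI impI)
  fix \<epsilon> :: real assume \<epsilon>: "\<epsilon> > 0"
  have D: "regular D" using assms by (simp add: regular_def)
  obtain r0 where r0: "0 < r0"
    "\<And>r x j. 0 < r \<Longrightarrow> r < r0 \<Longrightarrow> x \<in> {0..<1} \<Longrightarrow> 1 \<le> j \<Longrightarrow>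
       \<bar>(iet_map D ^^ j) x - x\<bar> < r \<Longrightarrow> real j powr - (1 + \<epsilon>) \<le> r"
    using condition_U_displacement[OF assms(6) \<epsilon>] by metis
  let ?d = "real CARD('a)"
  \<comment> \<open>The estimate below has constant part \<open>1 + 2 * ?d + 2 * ?d / r0\<close> and
    a term \<open>2 * ?d * M powr \<epsilon>\<close>; as \<open>M powr \<epsilon> \<ge> 1\<close>,
    both merge into this factor.\<close>
  define C where "C = 1 + 4 * ?d + 2 * ?d / r0"
  have "mat_norm (zorich_mat D k (k + 1)) \<le> C * mat_norm (zorich_mat D 0 k) powr \<epsilon>" for k
  proof -
    define z where "z = zorich_time D k"
    define E where "E = rv_iter D z"
    define R where "R = height D z (winner E)"
    define M where "M = mat_norm (zorich_mat D 0 k)"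
    obtain N \<alpha> where N: "zorich_time D (Suc k) = z + N"
      "\<And>i. i < N \<Longrightarrow> winner (rv_iter D (z + i)) = \<alpha>"
      using zorich_time_Suc[OF D, of k] unfolding z_def by metis
    \<comment> \<open>\<open>R\<close> is a row sum of \<open>Z(k)\<close>, so the bound in terms of
      \<open>R\<close> becomes one in terms of the norm.\<close>
    have "R \<le> M"
      unfolding R_def M_def zorich_mat_def z_def zorich_time.simps by (rule height_le_mat_norm)
    moreover have R: "1 \<le> R" unfolding R_def by (rule height_pos)
    ultimately have powr: "R powr \<epsilon> \<le> M powr \<epsilon>" and one: "1 \<le> M powr \<epsilon>"
      using \<epsilon> by (auto intro: powr_mono2 ge_one_powr_ge_zero)
    have "len E (winner E) / shift E \<le> 2 / r0 + 2 * R powr \<epsilon>"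
      unfolding E_def R_def by (rule winner_len_over_shift[OF D assms(5) r0])
    then have "?d * (len E (winner E) / shift E) \<le> ?d * (2 / r0 + 2 * M powr \<epsilon>)"
      using powr by (intro mult_left_mono) auto
    moreover have "N \<le> 1 + ?d + ?d * (len E (winner E) / shift E)"
      unfolding E_def using same_winner_count[OF D N(2)] by simp
    moreover have "mat_norm (zorich_mat D k (k + 1)) \<le> ?d + N"
      using rv_mat_same_winner[OF D N(2)] by (simp add: zorich_mat_def N(1) flip: z_def del: zorich_time.simps)
    ultimately have "mat_norm (zorich_mat D k (k + 1)) \<le>
        (1 + 2 * ?d + 2 * ?d / r0) * 1 + 2 * ?d * M powr \<epsilon>"
      by (simp add: algebra_simps)
    also have "\<dots> \<le> (1 + 2 * ?d + 2 * ?d / r0) * M powr \<epsilon> + 2 * ?d * M powr \<epsilon>"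
      by (intro add_right_mono mult_left_mono one) (use r0(1) in auto)
    also have "\<dots> = C * M powr \<epsilon>" by (simp add: C_def algebra_simps)
    finally show ?thesis by (simp add: M_def)
  qed
  moreover have "C > 0" using r0(1) by (simp add: C_def add_pos_nonneg)
  ultimately show "\<exists>C>0. \<forall>k\<ge>1.
      mat_norm (zorich_mat D k (k + 1)) \<le> C * mat_norm (zorich_mat D 0 k) powr \<epsilon>"
    by blast
qed

end
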